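(* Let $r\in\mathbb{N}$, let $p$ be a prime and let $a_1,\ldots,a_r\in \mathbb{N}$. Put $a_0:=0$ and assume that $a_0=0< a_1\le a_2\le \ldots \le a_r$. Then $$A(p^{a_1},\ldots,p^{a_r}) = p^{a_0+a_1+\ldots +a_{r-1}} + \left(1-\frac1{p}\right) \sum_{\ell=1}^r p^{a_0+a_1+\ldots +a_{\ell-1}}\sum_{j=a_{\ell-1}}^{a_{\ell}-1} p^{(r-\ell)j}.$$
   Context: $\mathbb{N}=\{1,2,\ldots\}$. For $m_1,\ldots,m_r\in\mathbb{N}$ the function $A$ is defined by $A(m_1,\ldots,m_r)=\frac1{m}\sum_{k=1}^m\gcd(k,m_1)\cdots\gcd(k,m_r)$ with $m=\operatorname{lcm}[m_1,\ldots,m_r]$. An inner sum with $a_{\ell-1}=a_\ell$ is empty, hence $0$. *)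

theory Defs
  imports Complex_Main "HOL-Computational_Algebra.Primes"
begin

text \<open>The tuple \<open>(m\<^sub>1, \<dots>, m\<^sub>r)\<close> is the restriction of \<open>m :: nat \<Rightarrow> nat\<close> to \<open>{1..r}\<close>;
  \<open>Lcm (m ` {1..r})\<close> is \<open>lcm[m\<^sub>1, \<dots>, m\<^sub>r]\<close>. The intended domain is \<open>r \<ge> 1\<close> and \<open>m i \<ge> 1\<close>
  for all \<open>i \<in> {1..r}\<close>, so that this least common multiple is nonzero.\<close>

definition gcd_mean :: "nat \<Rightarrow> (nat \<Rightarrow> nat) \<Rightarrow> real" where
  "gcd_mean r m =
     (1 / real (Lcm (m ` {1..r}))) * (\<Sum>k = 1..Lcm (m ` {1..r}). \<Prod>i = 1..r. real (gcd k (m i)))"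

end

theory Submission
  imports Defs "HOL-Number_Theory.Totient"
begin

text \<open>Put \<open>N = a r\<close>, so that the least common multiple is \<open>p ^ N\<close>. The summand depends on \<open>k\<close> only
  through \<open>gcd k (p ^ N) = p ^ j\<close>, and this value is taken \<open>totient (p ^ (N - j))\<close> times. For
  \<open>a (l - 1) \<le> j \<le> a l\<close> the product of the \<open>p ^ min j (a i)\<close> has the exponent
  \<open>a 1 + \<dots> + a (l - 1) + (r - l + 1) * j\<close>, and dividing by \<open>p ^ j\<close> leaves \<open>(r - l) * j\<close>.\<close>

text \<open>The weight \<open>totient (p ^ (N - j))\<close> equals
  \<open>p ^ N * (1 - 1 / p) / p ^ j\<close> for \<open>j < N\<close>, but it is 1 at
  \<open>j = N\<close>. This is why \<open>f (p ^ N)\<close> stands apart from the sum.\<close>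

lemma sum_gcd_prime_power:
  fixes f :: "nat \<Rightarrow> real"
  assumes "prime p"
  shows "(\<Sum>k = 1..p ^ N. f (gcd k (p ^ N))) =
    f (p ^ N) + real p ^ N * (1 - 1 / real p) * (\<Sum>j<N. f (p ^ j) / real p ^ j)"
proof -
  have p: "p > 1" using assms prime_gt_1_nat by blast
  let ?n = "p ^ N"
  have inj: "inj_on (\<lambda>j. p ^ j) {..N}"
    using p by (auto simp: inj_on_def)
  have "(\<Sum>k = 1..?n. f (gcd k ?n)) =
    (\<Sum>d\<in>(\<lambda>j. p ^ j) ` {..N}. \<Sum>k\<in>{k\<in>{1..?n}. gcd k ?n = d}. f (gcd k ?n))"
  proof (rule sum.group[symmetric])
    show "(\<lambda>k. gcd k ?n) ` {1..?n} \<subseteq> (\<lambda>j. p ^ j) ` {..N}"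
    proof (intro image_subsetI)
      fix k
      obtain j where "j \<le> N" "gcd k ?n = p ^ j"
        using divides_primepow_nat[OF assms, of "gcd k ?n" N] by auto
      then show "gcd k ?n \<in> (\<lambda>j. p ^ j) ` {..N}" by auto
    qed
  qed auto
  also have "\<dots> = (\<Sum>j\<le>N. \<Sum>k\<in>{k\<in>{1..?n}. gcd k ?n = p ^ j}. f (gcd k ?n))"
    by (rule sum.reindex_cong[OF inj]) auto
  also have "\<dots> = (\<Sum>j\<le>N. real (totient (p ^ (N - j))) * f (p ^ j))"
  proof (rule sum.cong[OF refl])
    fix j assume j: "j \<in> {..N}"
    have "{1..?n} = {0<..?n}" by auto
    moreover have "p ^ j dvd ?n" "?n div p ^ j = p ^ (N - j)"
      using j p by (auto simp: le_imp_power_dvd power_diff)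
    ultimately have "card {k\<in>{1..?n}. gcd k ?n = p ^ j} = totient (p ^ (N - j))"
      using card_gcd_eq_totient[of ?n "p ^ j"] p by simp
    then show "(\<Sum>k\<in>{k\<in>{1..?n}. gcd k ?n = p ^ j}. f (gcd k ?n)) =
        real (totient (p ^ (N - j))) * f (p ^ j)"
      by simp
  qed
  also have "\<dots> = f ?n + (\<Sum>j<N. real (totient (p ^ (N - j))) * f (p ^ j))"
    by (simp add: lessThan_Suc_atMost[symmetric])
  also have "(\<Sum>j<N. real (totient (p ^ (N - j))) * f (p ^ j)) =
      (\<Sum>j<N. real p ^ N * (1 - 1 / real p) * (f (p ^ j) / real p ^ j))"
  proof (rule sum.cong[OF refl])
    fix j assume "j \<in> {..<N}"
    \<comment> \<open>Writing \<open>N - j\<close> as \<open>Suc d\<close> removes the truncated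
      subtraction and exposes the positive exponent that the totient formula needs.\<close>
    then obtain d where d: "N = j + Suc d"
      using less_imp_Suc_add[of j N] by auto
    have "totient (p ^ (N - j)) = p ^ d * (p - 1)"
      using totient_prime_power[OF assms, of "Suc d"] d by simp
    then show "real (totient (p ^ (N - j))) * f (p ^ j) =
        real p ^ N * (1 - 1 / real p) * (f (p ^ j) / real p ^ j)"
      using p d by (simp add: of_nat_diff field_simps power_add)
  qed
  finally show ?thesis by (simp add: sum_distrib_left)
qed

lemma gcd_power_power_nat:
  fixes p :: nat
  shows "gcd (p ^ m) (p ^ n) = p ^ min m n"
  by (cases "m \<le> n") (simp_all add: le_imp_power_dvd gcd_proj1_iff gcd_proj2_iff)

lemma le_of_step_le:
  fixes a :: "nat \<Rightarrow> 'b :: preorder"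
  assumes "\<And>i. i < r \<Longrightarrow> a i \<le> a (Suc i)" and "i \<le> j" "j \<le> r"
  shows "a i \<le> a j"
  using assms(2,3) by (induction j rule: dec_induct) (auto intro: order_trans[OF _ assms(1)])

text \<open>The half-open blocks are glued one at a time, by induction on \<open>r\<close>. A block
  with \<open>a (l - 1) = a l\<close> is empty and adds 0.\<close>

lemma sum_consecutive_intervals:
  fixes F :: "nat \<Rightarrow> 'b :: comm_monoid_add" and a :: "nat \<Rightarrow> nat"
  assumes "\<And>i. i < r \<Longrightarrow> a i \<le> a (Suc i)"
  shows "(\<Sum>l = 1..r. \<Sum>j = a (l - 1)..<a l. F j) = (\<Sum>j = a 0..<a r. F j)"
  using assms
proof (induction r)
  case (Suc r)
  have "a 0 \<le> a r"
    using le_of_step_le[of r a 0 r] Suc.prems by simp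
  then show ?case using Suc by (simp add: sum.atLeastLessThan_concat)
qed simp

text \<open>The minimum is \<open>a i\<close> before position \<open>l\<close> and \<open>j\<close>
  from there on, which gives \<open>r - l + 1\<close> copies of \<open>j\<close>. One copy is kept
  apart, to cancel against a later division by \<open>p ^ j\<close>.\<close>

lemma sum_min_split:
  fixes a :: "nat \<Rightarrow> nat"
  assumes "1 \<le> l" "l \<le> r"
    and "\<And>i. i \<in> {1..<l} \<Longrightarrow> a i \<le> j" and "\<And>i. i \<in> {l..r} \<Longrightarrow> j \<le> a i"
  shows "(\<Sum>i = 1..r. min j (a i)) = (\<Sum>i = 1..<l. a i) + (r - l) * j + j"
proof -
  have "{1..r} = {1..<l} \<union> {l..r}" using assms(1,2) by auto
  then have "(\<Sum>i = 1..r. min j (a i)) = (\<Sum>i = 1..<l. min j (a i)) + (\<Sum>i = l..r. min j (a i))"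
    by (simp add: sum.union_disjoint[symmetric] ivl_disj_int)
  also have "(\<Sum>i = 1..<l. min j (a i)) = (\<Sum>i = 1..<l. a i)"
    using assms(3) by (intro sum.cong) (auto simp: min_def intro: antisym)
  also have "(\<Sum>i = l..r. min j (a i)) = (\<Sum>i = l..r. j)"
    using assms(4) by (intro sum.cong) (auto simp: min_absorb1)
  finally show ?thesis using assms(2) by (simp add: Suc_diff_le)
qed

theorem corollary15:
  fixes r p :: nat and a :: "nat \<Rightarrow> nat"
  assumes "r \<ge> 1"
    and "prime p"
    and "a 0 = 0"
    and "0 < a 1"
    and "\<And>i. 1 \<le> i \<Longrightarrow> i < r \<Longrightarrow> a i \<le> a (i + 1)"
  shows "gcd_mean r (\<lambda>i. p ^ a i) =
    real p ^ (\<Sum>i = 0..r - 1. a i) +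
    (1 - 1 / real p) *
      (\<Sum>l = 1..r. real p ^ (\<Sum>i = 0..l - 1. a i) * (\<Sum>j = a (l - 1)..<a l. real p ^ ((r - l) * j)))"
proof -
  let ?N = "a r"
  have p: "p > 0" using assms(2) prime_gt_0_nat by blast
  have step: "a i \<le> a (Suc i)" if "i < r" for i
    using assms(3) assms(5)[of i] that by (cases "i = 0") auto
  have mono: "a i \<le> a j" if "i \<le> j" "j \<le> r" for i j
    using le_of_step_le[of r a i j] step that by blast
  have Lcm: "Lcm ((\<lambda>i. p ^ a i) ` {1..r}) = p ^ ?N"
  proof (rule dvd_antisym)
    show "Lcm ((\<lambda>i. p ^ a i) ` {1..r}) dvd p ^ ?N"
      using mono by (auto intro!: Lcm_least le_imp_power_dvd)
    show "p ^ ?N dvd Lcm ((\<lambda>i. p ^ a i) ` {1..r})"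
      using assms(1) by (intro dvd_Lcm) auto
  qed
  define f where "f = (\<lambda>d. \<Prod>i = 1..r. real (gcd d (p ^ a i)))"
  \<comment> \<open>Each \<open>p ^ a i\<close> divides \<open>p ^ ?N\<close>, so taking the gcd
    with \<open>p ^ ?N\<close> first changes no factor.\<close>
  have f_gcd: "f (gcd k (p ^ ?N)) = f k" for k
    unfolding f_def using mono
    by (intro prod.cong) (auto simp: gcd.assoc gcd_power_power_nat min_absorb2)
  have f_power: "f (p ^ j) = real p ^ (\<Sum>i = 1..r. min j (a i))" for j
    by (simp add: f_def gcd_power_power_nat power_sum)
  have prefix: "(\<Sum>i = 0..l - 1. a i) = (\<Sum>i = 1..<l. a i)" if "1 \<le> l" for l
  proof -
    have "{0..l - 1} = insert 0 {1..<l}" using that by auto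
    then show ?thesis using assms(3) by simp
  qed
  have f_term: "f (p ^ j) / real p ^ j = real p ^ (\<Sum>i = 0..l - 1. a i) * real p ^ ((r - l) * j)"
    if "1 \<le> l" "l \<le> r" "a (l - 1) \<le> j" "j \<le> a l" for l j
  proof -
    have "a i \<le> j" if "i \<in> {1..<l}" for i
      using that \<open>l \<le> r\<close> order_trans[OF mono[of i "l - 1"] \<open>a (l - 1) \<le> j\<close>] by auto
    moreover have "j \<le> a i" if "i \<in> {l..r}" for i
      using that order_trans[OF \<open>j \<le> a l\<close> mono[of l i]] by auto
    ultimately have "(\<Sum>i = 1..r. min j (a i)) = (\<Sum>i = 0..l - 1. a i) + (r - l) * j + j"
      using sum_min_split[of l r a j] prefix[of l] that by simp
    then show ?thesis
      using p by (simp only: f_power power_add) simp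
  qed
  have "gcd_mean r (\<lambda>i. p ^ a i) = (\<Sum>k = 1..p ^ ?N. f (gcd k (p ^ ?N))) / real p ^ ?N"
    unfolding gcd_mean_def Lcm f_gcd by (simp add: f_def)
  also have "\<dots> = f (p ^ ?N) / real p ^ ?N + (1 - 1 / real p) * (\<Sum>j<?N. f (p ^ j) / real p ^ j)"
    unfolding sum_gcd_prime_power[OF assms(2)] using p by (simp add: add_divide_distrib)
  \<comment> \<open>With \<open>l = r\<close> the exponent \<open>(r - l) * j\<close> vanishes,
    leaving only the prefix sum.\<close>
  also have "f (p ^ ?N) / real p ^ ?N = real p ^ (\<Sum>i = 0..r - 1. a i)"
    using f_term[of r ?N] assms(1) mono by simp
  \<comment> \<open>Since \<open>a 0 = 0\<close>, the blocks between consecutive \<open>a l\<close>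
    tile all of \<open>{..<?N}\<close>, and \<open>f_term\<close> applies on each block.\<close>
  also have "(\<Sum>j<?N. f (p ^ j) / real p ^ j) =
      (\<Sum>l = 1..r. \<Sum>j = a (l - 1)..<a l. f (p ^ j) / real p ^ j)"
    using sum_consecutive_intervals[of r a "\<lambda>j. f (p ^ j) / real p ^ j"] step assms(3)
    by (simp add: lessThan_atLeast0)
  also have "\<dots> = (\<Sum>l = 1..r. real p ^ (\<Sum>i = 0..l - 1. a i) *
      (\<Sum>j = a (l - 1)..<a l. real p ^ ((r - l) * j)))"
    unfolding sum_distrib_left by (intro sum.cong[OF refl] f_term) auto
  finally show ?thesis .
qed

end
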